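(* Let $\theta>0$, $r>0$ and let the blocklength $l$ be a positive integer. Define the effective capacity of truncated HARQ-enabled D2D ($M=2$) under queue model $n_1$ as $EC^{\mathrm{HARQ}}_{n_1}=-\frac1\theta\log_e\rho(\mathbf B_{n_1})$, where $\rho$ denotes the spectral radius and $\mathbf B_{n_1}=\begin{bmatrix} b_{1,n_1}&b_{2,n_1}\\1&0\end{bmatrix}$ with $b_{1,n_1},b_{2,n_1}$ as given in the context. Then $$EC^{\mathrm{HARQ}}_{n_1}=-\frac1\theta\log_e\Big\{\tfrac12\Big(\big(e^{-lr\theta}\varphi+p^{\mathrm{off}}_u\big)+\sqrt{\big(e^{-lr\theta}\varphi+p^{\mathrm{off}}_u\big)^2+4\big(e^{-lr\theta}\vartheta+p^{\mathrm{off}}_o+\varepsilon_{ac}\big)}\Big)\Big\},$$ where $\varphi=p_{u,1}\alpha_d+p_{u,3}\alpha_{mC}+p_{u,5}\alpha_{MC}$, $\vartheta=p_{o,1}\beta_d+p_{o,3}\beta_{mC}+p_{o,5}\beta_{MC}$, $p^{\mathrm{off}}_u=p_{u,2}+p_{u,4}+p_{u,6}$, $p^{\mathrm{off}}_o=p_{o,2}+p_{o,4}+p_{o,6}$.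
   Context: Setting: a device $D_T$ sends packets to $D_R$ at fixed rate $r$ through one of three modes: direct ($d$), via a micro-cell base station ($mC$), via a macro-cell base station ($MC$). At most $M=2$ attempts are made per packet, the first in underlay settings (subscript $u$), the second in overlay settings (subscript $o$). In queue model $n_1$, a packet not decoded after $M$ attempts stays in the queue with reduced priority. $\theta$ is the QoS exponent, $l$ the length of a fading block. State probabilities. In each slot the link is in one of six states: states 1, 3, 5 mean that mode $d$, $mC$, $MC$ respectively is selected and the link is ON (its SNR, or in underlay its signal-to-interference ratio, exceeds $\gamma_{req}=2^{r/B}-1$, with $B>0$ the bandwidth), and states 2, 4, 6 mean that the respective mode is selected and the link is OFF. Mode selection and fading are independent of each other and over time, so the transition matrices have identical rows $\mathbf p_{o}=[p_{o,1},\dots,p_{o,6}]$ (overlay) and $\mathbf p_{u}=[p_{u,1},\dots,p_{u,6}]$ (underlay), which are probability vectors; each entry is the product of the probability of selecting the mode and the probability of the link being ON/OFF. Decoding error probabilities. For each mode $x\in\{d,mC,MC\}$ let $\gamma_x(k)>0$ be the overlay SNR and $\Gamma_x(k)>0$ the underlay signal-to-interference-and-noise ratio in block $k$ (positive random variables). With $Q(y)=\frac1{\sqrt{2\pi}}\int_y^\infty e^{-t^2/2}dt$, the overlay decoding error probability after $m$ attempts is $$\zeta^x_{o,m}=Q\left(\frac{\sum_{k=1}^m\log_2(1+\gamma_x(k))+\log(ml)/l-r}{\log_2 e\,\sqrt{\sum_{k=1}^m\frac{(2+\gamma_x(k))\gamma_x(k)}{l(\gamma_x(k)+1)^2}}}\right),$$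 and $\zeta^x_{u,m}$ is the same expression with $\Gamma_x$ in place of $\gamma_x$. $\mathbb E_z$ is expectation over the fading. Set $\varepsilon_x=\mathbb E_z[\zeta^x_{o,2}]$ (outage probability), $\varepsilon_{ac}=\varepsilon_d+\varepsilon_{mC}+\varepsilon_{MC}$, $\alpha_x=1-\mathbb E_z[\zeta^x_{u,1}]$, $\beta_x=\mathbb E_z[\zeta^x_{o,1}]-\varepsilon_x$. Matrix entries. With $\mathbf\Phi(-\theta)=\mathrm{diag}[e^{-lr\theta},1,e^{-lr\theta},1,e^{-lr\theta},1]$, $\mathbf q_1=[\alpha_d,1,\alpha_{mC},1,\alpha_{MC},1]$ and $\mathbf q_3=[\beta_d,1,\beta_{mC},1,\beta_{MC},1]$, $$b_{1,n_1}=\mathbf q_1\mathbf\Phi(-\theta)\mathbf p_u^{\top},\qquad b_{2,n_1}=\mathbf q_3\mathbf\Phi(-\theta)\mathbf p_o^{\top}+\varepsilon_{ac}.$$ *)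

theory Defs
  imports "HOL-Probability.Probability" "Jordan_Normal_Form.Spectral_Radius"
begin

datatype transmission_mode = Direct | MicroCell | MacroCell

fun on_state :: "transmission_mode \<Rightarrow> nat" where
  "on_state Direct = 1"
| "on_state MicroCell = 3"
| "on_state MacroCell = 5"

fun off_state :: "transmission_mode \<Rightarrow> nat" where
  "off_state Direct = 2"
| "off_state MicroCell = 4"
| "off_state MacroCell = 6"

definition gamma_req :: "real \<Rightarrow> real \<Rightarrow> real" where
  "gamma_req B r = 2 powr (r / B) - 1"

text \<open>
  Slots are fading blocks and are numbered from 1. In slot k, \<open>sel_o k\<close> and \<open>sel_u k\<close> are the modes
  selected in the overlay and in the underlay setting, \<open>\<gamma> x k\<close> is the overlay SNR, \<open>\<Gamma> x k\<close> the
  underlay SINR and \<open>\<sigma> x k\<close> the underlay SIR of mode x. The underlay link is ON when the SIR exceeds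
  the threshold, whereas its decoding error probability depends on the SINR. \<open>p_o\<close> and \<open>p_u\<close> are
  the rows of the two state transition matrices, with entries indexed by the states 1 to 6; that
  they do not depend on k expresses stationarity of the state process. Fading quantities of the same
  slot may be dependent on each other.
\<close>

locale d2d_link = prob_space M
  for M :: "'a measure" +
  fixes sel_o sel_u :: "nat \<Rightarrow> 'a \<Rightarrow> transmission_mode"
    and \<gamma> \<Gamma> \<sigma> :: "transmission_mode \<Rightarrow> nat \<Rightarrow> 'a \<Rightarrow> real"
    and p_o p_u :: "nat \<Rightarrow> real"
    and B r :: real
  assumes bandwidth_pos: "B > 0"
    and sel_o_rv: "k \<ge> 1 \<Longrightarrow> random_variable (count_space UNIV) (sel_o k)"
    and sel_u_rv: "k \<ge> 1 \<Longrightarrow> random_variable (count_space UNIV) (sel_u k)"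
    and snr_rv: "k \<ge> 1 \<Longrightarrow> random_variable borel (\<gamma> x k)"
    and sinr_rv: "k \<ge> 1 \<Longrightarrow> random_variable borel (\<Gamma> x k)"
    and sir_rv: "k \<ge> 1 \<Longrightarrow> random_variable borel (\<sigma> x k)"
    and snr_pos: "k \<ge> 1 \<Longrightarrow> \<omega> \<in> space M \<Longrightarrow> \<gamma> x k \<omega> > 0"
    and sinr_pos: "k \<ge> 1 \<Longrightarrow> \<omega> \<in> space M \<Longrightarrow> \<Gamma> x k \<omega> > 0"
    and selection_indep_fading: "k \<ge> 1 \<Longrightarrow>
      indep_set
        (sets (vimage_algebra (space M) (\<lambda>\<omega>. (sel_o k \<omega>, sel_u k \<omega>)) (count_space UNIV)))
        (sets (vimage_algebra (space M) (\<lambda>\<omega> x. (\<gamma> x k \<omega>, \<Gamma> x k \<omega>, \<sigma> x k \<omega>))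
          (Pi\<^sub>M UNIV (\<lambda>_. borel))))"
    and indep_over_time:
      "indep_vars (\<lambda>_. count_space UNIV \<Otimes>\<^sub>M Pi\<^sub>M UNIV (\<lambda>_. borel))
        (\<lambda>k \<omega>. ((sel_o k \<omega>, sel_u k \<omega>), (\<lambda>x. (\<gamma> x k \<omega>, \<Gamma> x k \<omega>, \<sigma> x k \<omega>)))) {1..}"
    and p_o_on: "k \<ge> 1 \<Longrightarrow> p_o (on_state x) =
      prob {\<omega> \<in> space M. sel_o k \<omega> = x} * prob {\<omega> \<in> space M. \<gamma> x k \<omega> > gamma_req B r}"
    and p_o_off: "k \<ge> 1 \<Longrightarrow> p_o (off_state x) =
      prob {\<omega> \<in> space M. sel_o k \<omega> = x} * prob {\<omega> \<in> space M. \<not> \<gamma> x k \<omega> > gamma_req B r}"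
    and p_u_on: "k \<ge> 1 \<Longrightarrow> p_u (on_state x) =
      prob {\<omega> \<in> space M. sel_u k \<omega> = x} * prob {\<omega> \<in> space M. \<sigma> x k \<omega> > gamma_req B r}"
    and p_u_off: "k \<ge> 1 \<Longrightarrow> p_u (off_state x) =
      prob {\<omega> \<in> space M. sel_u k \<omega> = x} * prob {\<omega> \<in> space M. \<not> \<sigma> x k \<omega> > gamma_req B r}"
begin

lemma mode_split:
  assumes s: "random_variable (count_space UNIV) s"
    and g: "\<And>x. random_variable borel (g x)"
    and on: "\<And>x. p (on_state x) =
      prob {\<omega> \<in> space M. s \<omega> = x} * prob {\<omega> \<in> space M. g x \<omega> > (c::real)}"
    and off: "\<And>x. p (off_state x) =
      prob {\<omega> \<in> space M. s \<omega> = x} * prob {\<omega> \<in> space M. \<not> g x \<omega> > c}"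
  shows "(\<forall>i\<in>{1..6}. p i \<ge> 0) \<and> (\<Sum>i=1..6. p i) = 1"
proof -
  have pos: "p (on_state x) \<ge> 0" "p (off_state x) \<ge> 0" for x
    unfolding on off by auto
  have idx: "{1..6::nat} = {1,2,3,4,5,6}" by auto
  have ev: "{\<omega> \<in> space M. g x \<omega> > c} \<in> events" for x
    using g[of x] by measurable
  have "prob {\<omega> \<in> space M. \<not> g x \<omega> > c} = 1 - prob {\<omega> \<in> space M. g x \<omega> > c}" for x
    by (rule prob_neg[OF ev])
  then have m: "p (on_state x) + p (off_state x) = prob {\<omega> \<in> space M. s \<omega> = x}" for x
    unfolding on off distrib_left[symmetric] by simp
  have sev: "{\<omega> \<in> space M. s \<omega> = x} \<in> events" for x
    using measurable_sets[OF s, of "{x}"] by (simp add: vimage_def Int_def conj_commute)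
  have U: "(UNIV :: transmission_mode set) = {Direct, MicroCell, MacroCell}"
    using transmission_mode.exhaust by auto
  have "prob (\<Union>x\<in>UNIV. {\<omega> \<in> space M. s \<omega> = x}) = (\<Sum>x\<in>UNIV. prob {\<omega> \<in> space M. s \<omega> = x})"
  proof (rule finite_measure_finite_Union)
    show "finite (UNIV :: transmission_mode set)" unfolding U by simp
  qed (use sev in \<open>auto simp: disjoint_family_on_def\<close>)
  moreover have "(\<Union>x\<in>UNIV. {\<omega> \<in> space M. s \<omega> = x}) = space M" by auto
  ultimately have "(\<Sum>x\<in>UNIV. p (on_state x) + p (off_state x)) = 1"
    using prob_space by (simp add: m)
  then have "(\<Sum>i=1..6. p i) = 1" unfolding U idx by simp
  moreover have "\<forall>i\<in>{1..6}. p i \<ge> 0"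
    using pos[of Direct] pos[of MicroCell] pos[of MacroCell] unfolding idx by simp
  ultimately show ?thesis by blast
qed

lemma p_o_probability_vector: "\<forall>i\<in>{1..6}. p_o i \<ge> 0" "(\<Sum>i=1..6. p_o i) = 1"
  using mode_split[OF sel_o_rv[of 1] snr_rv[of 1] p_o_on[of 1] p_o_off[of 1]] by auto

lemma p_u_probability_vector: "\<forall>i\<in>{1..6}. p_u i \<ge> 0" "(\<Sum>i=1..6. p_u i) = 1"
  using mode_split[OF sel_u_rv[of 1] sir_rv[of 1] p_u_on[of 1] p_u_off[of 1]] by auto

end

definition Q_function :: "real \<Rightarrow> real" where
  "Q_function y = 1 / sqrt (2 * pi) * (LBINT t:{y..}. exp (- (t\<^sup>2 / 2)))"

text \<open>
  The term \<open>log(ml)/l\<close> of the finite-blocklength approximation is written without a base in the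
  literature; its base is therefore the parameter a.
\<close>

definition decoding_error :: "real \<Rightarrow> real \<Rightarrow> nat \<Rightarrow> nat \<Rightarrow> (nat \<Rightarrow> real) \<Rightarrow> real" where
  "decoding_error a r l m g =
    Q_function (((\<Sum>k=1..m. log 2 (1 + g k)) + log a (real (m * l)) / real l - r) /
      (log 2 (exp 1) * sqrt (\<Sum>k=1..m. (2 + g k) * g k / (real l * (g k + 1)\<^sup>2))))"

definition mean_decoding_error ::
  "'a measure \<Rightarrow> real \<Rightarrow> real \<Rightarrow> nat \<Rightarrow> nat \<Rightarrow> (nat \<Rightarrow> 'a \<Rightarrow> real) \<Rightarrow> real" where
  "mean_decoding_error M a r l m g = (\<integral>\<omega>. decoding_error a r l m (\<lambda>k. g k \<omega>) \<partial>M)"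

definition Phi :: "nat \<Rightarrow> real \<Rightarrow> real \<Rightarrow> real mat" where
  "Phi l r t = (let e = exp (real l * r * t) in mat_diag 6 (\<lambda>i. [e, 1, e, 1, e, 1] ! i))"

definition state_row :: "(nat \<Rightarrow> real) \<Rightarrow> real Matrix.vec" where
  "state_row p = vec_of_list [p 1, p 2, p 3, p 4, p 5, p 6]"

definition weight_row :: "(transmission_mode \<Rightarrow> real) \<Rightarrow> real Matrix.vec" where
  "weight_row f = vec_of_list [f Direct, 1, f MicroCell, 1, f MacroCell, 1]"

definition eps_ac :: "(transmission_mode \<Rightarrow> real) \<Rightarrow> real" where
  "eps_ac \<epsilon> = \<epsilon> Direct + \<epsilon> MicroCell + \<epsilon> MacroCell"

definition b1_n1 ::
  "real \<Rightarrow> real \<Rightarrow> nat \<Rightarrow> (transmission_mode \<Rightarrow> real) \<Rightarrow> (nat \<Rightarrow> real) \<Rightarrow> real" where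
  "b1_n1 \<theta> r l \<alpha> p_u = scalar_prod (weight_row \<alpha>) (Phi l r (- \<theta>) *\<^sub>v state_row p_u)"

definition b2_n1 ::
  "real \<Rightarrow> real \<Rightarrow> nat \<Rightarrow> (transmission_mode \<Rightarrow> real) \<Rightarrow> (transmission_mode \<Rightarrow> real) \<Rightarrow>
    (nat \<Rightarrow> real) \<Rightarrow> real" where
  "b2_n1 \<theta> r l \<beta> \<epsilon> p_o =
    scalar_prod (weight_row \<beta>) (Phi l r (- \<theta>) *\<^sub>v state_row p_o) + eps_ac \<epsilon>"

definition B_n1 :: "real \<Rightarrow> real \<Rightarrow> real mat" where
  "B_n1 b1 b2 = mat_of_rows_list 2 [[b1, b2], [1, 0]]"

definition EC_HARQ_n1 ::
  "real \<Rightarrow> real \<Rightarrow> nat \<Rightarrow> (transmission_mode \<Rightarrow> real) \<Rightarrow> (transmission_mode \<Rightarrow> real) \<Rightarrow>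
    (transmission_mode \<Rightarrow> real) \<Rightarrow> (nat \<Rightarrow> real) \<Rightarrow> (nat \<Rightarrow> real) \<Rightarrow> real" where
  "EC_HARQ_n1 \<theta> r l \<alpha> \<beta> \<epsilon> p_u p_o =
    - (1 / \<theta>) * ln (spectral_radius
      (map_mat complex_of_real (B_n1 (b1_n1 \<theta> r l \<alpha> p_u) (b2_n1 \<theta> r l \<beta> \<epsilon> p_o))))"

end

(* The spectral radius of the 2x2 matrix with rows (b, c) and (1, 0) is its larger real eigenvalue,
   the positive root of z^2 - b z - c, as soon as b and c are nonnegative. So it remains to see that
   b1 and b2 are nonnegative. This holds because mean decoding errors lie in [0,1] and the outage
   probabilities in eps_ac outweigh the possibly negative terms of b2. *)

theory Submission
  imports Defs
begin

lemma det_mat_2: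
  fixes A :: "'a :: comm_ring_1 mat"
  assumes "A \<in> carrier_mat 2 2"
  shows "Determinant.det A = A $$ (0,0) * A $$ (1,1) - A $$ (0,1) * A $$ (1,0)"
proof -
  have "Determinant.det A = (\<Sum>i<2. A $$ (i,0) * cofactor A i 0)"
    by (rule laplace_expansion_column[OF assms]) simp
  \<comment> \<open>Deleting row \<open>i\<close> and column 0 leaves the single entry in row
    \<open>1 - i\<close> and column 1, taken with sign \<open>(-1)^i\<close>.\<close>
  also have "cofactor A i 0 = (if i = 0 then A $$ (1,1) else - A $$ (0,1))" if "i < 2" for i
    using assms that by (subst cofactor_def, subst det_single)
      (auto simp: mat_delete_def less_2_cases_iff)
  then have "(\<Sum>i<2. A $$ (i,0) * cofactor A i 0) =
      (\<Sum>i<2. A $$ (i,0) * (if i = 0 then A $$ (1,1) else - A $$ (0,1)))"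
    by (intro sum.cong) auto
  finally show ?thesis
    by (simp add: lessThan_Suc numeral_2_eq_2)
qed

lemma spectral_radius_companion:
  assumes "b \<ge> 0" and "c \<ge> 0"
  shows "spectral_radius (map_mat complex_of_real (B_n1 b c)) = 1 / 2 * (b + sqrt (b\<^sup>2 + 4 * c))"
proof -
  let ?A = "map_mat complex_of_real (B_n1 b c)"
  define s where "s = sqrt (b\<^sup>2 + 4 * c)"
  have s2: "s\<^sup>2 = b\<^sup>2 + 4 * c"
    using assms by (simp add: s_def)
  have "s \<ge> b"
    using assms by (auto simp: s_def intro: real_le_rsqrt)
  have carrier: "?A \<in> carrier_mat 2 2"
    by (auto simp: B_n1_def mat_of_rows_list_def)
  \<comment> \<open>These are the two roots of z^2 - b z - c. Both are real because c is
    nonnegative, and Vieta's formulas recover b and c from them.\<close>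
  define u v where "u = (b + s) / 2" and "v = (b - s) / 2"
  have b: "b = u + v" and c: "c = - u * v"
    using s2 by (simp_all add: u_def v_def field_simps power2_eq_square)
  have "eigenvalue ?A z \<longleftrightarrow> z = of_real u \<or> z = of_real v" for z
  proof -
    have "eigenvalue ?A z \<longleftrightarrow> det (char_matrix ?A z) = 0"
      by (rule eigenvalue_det[OF carrier])
    also have "det (char_matrix ?A z) = z\<^sup>2 - b * z - c"
      by (subst det_mat_2[OF char_matrix_closed[OF carrier]])
        (simp add: char_matrix_def B_n1_def mat_of_rows_list_def algebra_simps power2_eq_square)
    also have "\<dots> = (z - of_real u) * (z - of_real v)"
      by (simp add: b c algebra_simps power2_eq_square)
    finally show ?thesis by simp
  qed
  then have "spectrum ?A = {of_real u, of_real v}"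
    by (auto simp: spectrum_def)
  then have "spectral_radius ?A = max \<bar>u\<bar> \<bar>v\<bar>"
    unfolding spectral_radius_def by simp
  \<comment> \<open>Since s is at least b, \<open>v\<close> is at most 0 and its modulus is (s - b)
    / 2, which cannot exceed \<open>u\<close> because b is nonnegative.\<close>
  also have "\<dots> = (b + s) / 2"
    using assms \<open>s \<ge> b\<close> unfolding u_def v_def by (simp add: max_def)
  finally show ?thesis by (simp add: s_def)
qed

text \<open>\<open>Q_function\<close> is the upper tail of the standard normal density, which is
  nonnegative and has total mass 1.\<close>

lemma Q_function_bounds: "0 \<le> Q_function y" "Q_function y \<le> 1"
proof -
  have Q: "Q_function y = (LBINT t:{y..}. std_normal_density t)"
    by (simp add: Q_function_def std_normal_density_def)
  show "0 \<le> Q_function y"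
    unfolding Q set_lebesgue_integral_def by (intro integral_nonneg_AE) simp
  have "(LBINT t:{y..}. std_normal_density t) \<le> (LBINT t. std_normal_density t)"
    unfolding set_lebesgue_integral_def
    by (intro integral_mono integrable_mult_indicator[unfolded real_scaleR_def])
      (auto simp: indicator_def)
  then show "Q_function y \<le> 1"
    unfolding Q by simp
qed

text \<open>Every decoding error is a value of \<open>Q_function\<close>, and averaging over a
  probability measure stays within [0,1].\<close>

lemma (in prob_space) mean_decoding_error_bounds:
  "0 \<le> mean_decoding_error M a r l m g" "mean_decoding_error M a r l m g \<le> 1"
proof -
  have bounds: "0 \<le> decoding_error a r l m h" "decoding_error a r l m h \<le> 1" for h
    unfolding decoding_error_def by (rule Q_function_bounds)+
  show "0 \<le> mean_decoding_error M a r l m g"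
    unfolding mean_decoding_error_def by (intro integral_nonneg_AE) (simp add: bounds)
  show "mean_decoding_error M a r l m g \<le> 1"
  proof (cases "integrable M (\<lambda>\<omega>. decoding_error a r l m (\<lambda>k. g k \<omega>))")
    case True
    then show ?thesis
      unfolding mean_decoding_error_def by (intro integral_le_const) (simp_all add: bounds)
  next
    \<comment> \<open>The Bochner integral of a non-integrable function is 0 by convention, so the
      bound holds here too.\<close>
    case False
    then show ?thesis
      by (simp add: mean_decoding_error_def not_integrable_integral_eq)
  qed
qed

text \<open>As \<open>Phi\<close> is diagonal, each state contributes one term: ON states carry the
  exponential factor and the weight of their mode, OFF states only their probability. This serves
  both b1 and b2.\<close>

lemma weighted_state_product:
  "scalar_prod (weight_row f) (Phi l r (- \<theta>) *\<^sub>v state_row p) =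
    exp (- (real l * r * \<theta>)) * (p 1 * f Direct + p 3 * f MicroCell + p 5 * f MacroCell) +
      (p 2 + p 4 + p 6)"
  by (simp add: weight_row_def state_row_def Phi_def Let_def scalar_prod_def mat_diag_def
      mult_mat_vec_def Matrix.row_def numeral_eq_Suc vec_of_list_index algebra_simps)

theorem mainTheorem2:
  fixes M :: "'a measure"
    and sel_o sel_u :: "nat \<Rightarrow> 'a \<Rightarrow> transmission_mode"
    and \<gamma> \<Gamma> \<sigma> :: "transmission_mode \<Rightarrow> nat \<Rightarrow> 'a \<Rightarrow> real"
    and p_o p_u :: "nat \<Rightarrow> real"
    and \<epsilon> \<alpha> \<beta> :: "transmission_mode \<Rightarrow> real"
    and B r \<theta> a varphi vartheta p_off_u p_off_o :: real
    and l :: nat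
  assumes link: "d2d_link M sel_o sel_u \<gamma> \<Gamma> \<sigma> p_o p_u B r"
    and \<theta>_pos: "\<theta> > 0" and r_pos: "r > 0" and l_pos: "l > 0" and log_base: "a > 1"
    and \<epsilon>_eq: "\<And>x. \<epsilon> x = mean_decoding_error M a r l 2 (\<gamma> x)"
    and \<alpha>_eq: "\<And>x. \<alpha> x = 1 - mean_decoding_error M a r l 1 (\<Gamma> x)"
    and \<beta>_eq: "\<And>x. \<beta> x = mean_decoding_error M a r l 1 (\<gamma> x) - \<epsilon> x"
    and varphi_eq: "varphi = p_u 1 * \<alpha> Direct + p_u 3 * \<alpha> MicroCell + p_u 5 * \<alpha> MacroCell"
    and vartheta_eq: "vartheta = p_o 1 * \<beta> Direct + p_o 3 * \<beta> MicroCell + p_o 5 * \<beta> MacroCell"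
    and p_off_u_eq: "p_off_u = p_u 2 + p_u 4 + p_u 6"
    and p_off_o_eq: "p_off_o = p_o 2 + p_o 4 + p_o 6"
  shows "EC_HARQ_n1 \<theta> r l \<alpha> \<beta> \<epsilon> p_u p_o =
    - (1 / \<theta>) * ln (1 / 2 * ((exp (- (real l * r * \<theta>)) * varphi + p_off_u) +
      sqrt ((exp (- (real l * r * \<theta>)) * varphi + p_off_u)\<^sup>2 +
        4 * (exp (- (real l * r * \<theta>)) * vartheta + p_off_o + eps_ac \<epsilon>))))"
proof -
  interpret d2d_link M sel_o sel_u \<gamma> \<Gamma> \<sigma> p_o p_u B r
    by (rule link)
  let ?e = "exp (- (real l * r * \<theta>))"
  have p_u: "p_u i \<ge> 0" if "i \<in> {1..6}" for i
    using p_u_probability_vector(1) that by blast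
  have p_o: "p_o i \<ge> 0" if "i \<in> {1..6}" for i
    using p_o_probability_vector(1) that by blast
  \<comment> \<open>A nonnegative summand is at most the total, which is 1. This keeps the negative
    part of \<open>\<beta> x\<close> within reach of \<open>\<epsilon> x\<close>.\<close>
  have p_o_le: "p_o i \<le> 1" if "i \<in> {1..6}" for i
    using member_le_sum[OF that, of p_o] p_o p_o_probability_vector(2) by simp
  have e: "?e \<le> 1"
    using \<theta>_pos r_pos by simp
  have "\<alpha> x \<ge> 0" for x
    unfolding \<alpha>_eq using mean_decoding_error_bounds(2) by simp
  then have "varphi \<ge> 0" "p_off_u \<ge> 0"
    unfolding varphi_eq p_off_u_eq using p_u by simp_all
  then have b1: "?e * varphi + p_off_u \<ge> 0"
    by simp
  have \<epsilon>: "\<epsilon> x \<ge> 0" for x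
    unfolding \<epsilon>_eq by (rule mean_decoding_error_bounds)
  \<comment> \<open>\<open>\<beta> x\<close> may be negative, but \<open>\<beta> x \<ge> - \<epsilon> x\<close> and its weight \<open>?e * p_o i\<close> is at most 1.\<close>
  have "?e * (p_o i * \<beta> x) + \<epsilon> x \<ge> 0" if "i \<in> {1..6}" for i x
  proof -
    have "?e * p_o i \<le> 1"
      using mult_mono[OF e p_o_le[OF that]] p_o[OF that] by simp
    then have "?e * p_o i * \<epsilon> x \<le> \<epsilon> x"
      using p_o[OF that] by (intro mult_left_le_one_le \<epsilon>) simp_all
    moreover have "?e * p_o i * \<beta> x \<ge> ?e * p_o i * (- \<epsilon> x)"
      unfolding \<beta>_eq using mean_decoding_error_bounds(1) p_o[OF that] by (intro mult_left_mono) simp_all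
    ultimately show ?thesis by simp
  qed
  \<comment> \<open>\<open>eps_ac\<close> supplies one outage probability per mode, so the ON term
    of each mode is offset by its own summand; the OFF probabilities only add to the sum.\<close>
  from this[of 1 Direct] this[of 3 MicroCell] this[of 5 MacroCell]
  have b2: "?e * vartheta + p_off_o + eps_ac \<epsilon> \<ge> 0"
    using p_o[of 2] p_o[of 4] p_o[of 6]
    by (simp add: vartheta_eq p_off_o_eq eps_ac_def distrib_left)
  have "b1_n1 \<theta> r l \<alpha> p_u = ?e * varphi + p_off_u"
    and "b2_n1 \<theta> r l \<beta> \<epsilon> p_o = ?e * vartheta + p_off_o + eps_ac \<epsilon>"
    unfolding b1_n1_def b2_n1_def weighted_state_product
    by (simp_all add: varphi_eq p_off_u_eq vartheta_eq p_off_o_eq)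
  then show ?thesis
    unfolding EC_HARQ_n1_def by (simp only: spectral_radius_companion[OF b1 b2])
qed

end
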